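(* Any (malicious) user registered in the searchable encryption system DCC-SE can break its KT-IND-CKA security (keyword trapdoor indistinguishability against chosen keyword attacks), in the revised game described in the context, where the adversary, being a registered user, is given the secret token $\tau$ and the partial key $\eta$ of the current epoch. Concretely, let $\mathcal{A}$ be the following adversary. It makes no ciphertext or trapdoor queries in either query phase. It randomly chooses two keywords $w_0,w_1$ and submits them. On receiving the challenge trapdoor $T^*_{w_b}=(T_1,T_2)$, it uses $\eta$ to generate for itself a ciphertext for $w_0$, with keyword part $(C_1,C_2,C_3,C_5,C_6)$. It then computes $\mathbb{C}_6=H_3\big([(C_5-C_1T_1)-C_3]\,T_2C_2\big)$, as in the test algorithm, and outputs $b'=0$ if $\mathbb{C}_6=C_6$ and $b'=1$ otherwise. Then: - if $b=0$, $\mathbb{C}_6=H_3(rhH(w_0)P)=C_6$, so $\mathcal{A}$ outputs $b'=0$; - if $b=1$, $\mathbb{C}_6=H_3(rhH(w_1)P)\neq H_3(rhH(w_0)P)=C_6$, so $\mathcal{A}$ outputs $b'=1$. Hence $\mathcal{A}$ always correctly determines $b$, and consequently its advantage in winning the game is non-negligible.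
   Context: **Setting.** $\mathbb{G}$ is an additively written cyclic group of prime order $q$ with generator $P$. $H,H_1,H_2,H_3$ are the hash functions of the scheme; $H$ and $H_2$ give scalars modulo $q$, and $H_1$ gives elements of $\mathbb{G}$. $\mathbb{GP}$ denotes the public parameters. **Keys.** A data sender $\mathcal{S}$ has public key $\mathcal{X}=xP$ with secret key $x$. Receivers $\mathcal{R}_1,\dots,\mathcal{R}_n$, indexed by $I=\{1,\dots,n\}$, have secret keys $y_j$ and public keys $\mathcal{Y}_j=y_jP$. The committee nodes hold a secret key $s$. **Registered users.** A user is registered if it has received the secret token $\tau$ of the current epoch from the certificate authority and has obtained the partial key $\eta$ of the current epoch from the committee nodes, where $\eta=H_2(\sigma_u)$ and $\sigma_u=s\cdot H_1(\tau)$. All registered users, including malicious ones, hold the same $\tau$ and the same $\eta$. The sender $\mathcal{S}$ itself is not regarded as a malicious user. **Encryption of a keyword $w$** (using $\eta$, $\mathcal{X}$ and the $\mathcal{Y}_j$). Set $\beta=H_2(\eta\mathcal{X})$, choose $r,h$ uniformly at random from $\mathbb{Z}_q^*$, and let the keyword part of the ciphertext be $(C_1,C_2,C_3,C_5,C_6)$ with $$C_1=r/\beta,\quad C_2=h/\beta,\quad C_3=rP,\quad C_5=\sum_{j\in I}r\mathcal{Y}_j,\quad C_6=H_3\big(rhH(w)P\big).$$ A full ciphertext also has a component for the document $f_m$, which is not used here. **Trapdoor of receiver $\mathcal{R}_i$ for a keyword $w$.** $T_w=(T_1,T_2)$ with $$T_1=\sum_{j\in I\setminus\{i\}}\beta\mathcal{Y}_j,\qquad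 T_2=(y_i-1)^{-1}\beta H(w),\qquad \beta=H_2(\eta\mathcal{X}).$$ **Test.** A keyword ciphertext and a trapdoor are declared to match when $H_3\big([(C_5-C_1T_1)-C_3]\,T_2C_2\big)=C_6$. **Revised KT-IND-CKA game** between a challenger $\mathcal{B}$ and an adversary $\mathcal{A}$: 1. *Setup.* $\mathcal{B}$ gives $\mathcal{A}$ the public key $\mathcal{X}$ of the sender, the public keys $\mathcal{Y}_1,\dots,\mathcal{Y}_n$ of the receivers, and, since $\mathcal{A}$ is a registered user, the secret token $\tau$ and partial key $\eta$ of the current epoch. (In the original game $\tau$ and $\eta$ are not given to $\mathcal{A}$.) 2. *Query 1.* $\mathcal{A}$ may query ciphertexts and trapdoors. 3. *Challenge.* $\mathcal{A}$ submits two keywords $w_0,w_1$ for a document $f_m$. $\mathcal{B}$ chooses $b\in\{0,1\}$ at random and returns the trapdoor $T^*_{w_b}$ for $w_b$ of receiver $\mathcal{R}_i$, for some $i\in\{1,\dots,n\}$. 4. *Query 2.* $\mathcal{A}$ may again query ciphertexts and trapdoors. 5. *Guess.* $\mathcal{A}$ outputs $b'\in\{0,1\}$ and wins if $b'=b$. The advantage of $\mathcal{A}$ measures how far $\Pr[b'=b]$ is from $\tfrac12$.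
   Formalization: The claim for b=1 and "always correct" assume H separates w0 and w1 and H3 is injective on the group; non-negligible advantage is also shown if collisions of H and H3 have negligible probability. Without this it fails (constant H3). Inverses of β and y_j−1 are assumed to exist. *)

theory Defs
  imports
    "HOL-Probability.Probability"
    "HOL-Algebra.Ring"
    "HOL-Algebra.Coset"
    "HOL-Number_Theory.Modular_Inverse"
begin

section \<open>The scheme\<close>

text \<open>
  The group is written additively, so only the additive part of the HOL-Algebra record is used
  and its multiplication is irrelevant. Scalars are integers; the representatives in
  \<open>{0..<q}\<close> stand for the elements of \<open>\<int>\<^sub>q\<close>, where \<open>q\<close> is the order of the group.
\<close>

record ('g, 'kw, 'tok, 'b) params =
  grp :: "'g ring"
  gen :: 'g
  receivers :: nat
  hash :: "'kw \<Rightarrow> int"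
  hash1 :: "'tok \<Rightarrow> 'g"
  hash2 :: "'g \<Rightarrow> int"
  hash3 :: "'g \<Rightarrow> 'b"

definition modulus :: "('g, 'kw, 'tok, 'b) params \<Rightarrow> int" where
  "modulus pp = int (order (grp pp))"

definition index_set :: "('g, 'kw, 'tok, 'b) params \<Rightarrow> nat set" where
  "index_set pp = {1..receivers pp}"

definition valid_params :: "('g, 'kw, 'tok, 'b) params \<Rightarrow> bool" where
  "valid_params pp \<longleftrightarrow>
     abelian_group (grp pp) \<and> prime (order (grp pp)) \<and>
     gen pp \<in> carrier (grp pp) \<and>
     carrier (grp pp) = range (\<lambda>k::int. [k] \<cdot>\<^bsub>grp pp\<^esub> gen pp) \<and>
     (\<forall>w. hash pp w \<in> {0..<modulus pp}) \<and>
     (\<forall>t. hash1 pp t \<in> carrier (grp pp)) \<and>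
     (\<forall>A\<in>carrier (grp pp). hash2 pp A \<in> {0..<modulus pp})"

record 'tok secrets =
  sender_key :: int
  receiver_key :: "nat \<Rightarrow> int"
  committee_key :: int
  token :: 'tok

definition sender_pub :: "('g, 'kw, 'tok, 'b) params \<Rightarrow> 'tok secrets \<Rightarrow> 'g" where
  "sender_pub pp S = [sender_key S] \<cdot>\<^bsub>grp pp\<^esub> gen pp"

definition receiver_pub :: "('g, 'kw, 'tok, 'b) params \<Rightarrow> 'tok secrets \<Rightarrow> nat \<Rightarrow> 'g" where
  "receiver_pub pp S = (\<lambda>j\<in>index_set pp. [receiver_key S j] \<cdot>\<^bsub>grp pp\<^esub> gen pp)"

definition partial_key :: "('g, 'kw, 'tok, 'b) params \<Rightarrow> 'tok secrets \<Rightarrow> int" where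
  "partial_key pp S = hash2 pp ([committee_key S] \<cdot>\<^bsub>grp pp\<^esub> hash1 pp (token S))"

definition beta :: "('g, 'kw, 'tok, 'b) params \<Rightarrow> int \<Rightarrow> 'g \<Rightarrow> int" where
  "beta pp \<eta> X = hash2 pp ([\<eta>] \<cdot>\<^bsub>grp pp\<^esub> X)"

text \<open>
  The last two conditions say that the inverses \<open>1 / \<beta>\<close> and \<open>(y\<^sub>j - 1)\<^sup>-\<^sup>1\<close> occurring in
  ciphertexts and trapdoors exist (\<^const>\<open>modular_inverse\<close> has the default value 0 otherwise).
\<close>

definition valid_secrets :: "('g, 'kw, 'tok, 'b) params \<Rightarrow> 'tok secrets \<Rightarrow> bool" where
  "valid_secrets pp S \<longleftrightarrow>
     sender_key S \<in> {0..<modulus pp} \<and>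
     (\<forall>j\<in>index_set pp. receiver_key S j \<in> {0..<modulus pp}) \<and>
     committee_key S \<in> {0..<modulus pp} \<and>
     beta pp (partial_key pp S) (sender_pub pp S) \<noteq> 0 \<and>
     (\<forall>j\<in>index_set pp. receiver_key S j \<noteq> 1)"

datatype ('g, 'b) ciphertext = Ciphertext (C1: int) (C2: int) (C3: 'g) (C5: 'g) (C6: 'b)

datatype 'g trapdoor = Trapdoor (T1: 'g) (T2: int)

definition ciphertext_with ::
  "('g, 'kw, 'tok, 'b) params \<Rightarrow> int \<Rightarrow> 'g \<Rightarrow> (nat \<Rightarrow> 'g) \<Rightarrow> 'kw \<Rightarrow> int \<Rightarrow> int
     \<Rightarrow> ('g, 'b) ciphertext" where
  "ciphertext_with pp \<eta> X Y w r h =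
     (let q = modulus pp; \<beta> = beta pp \<eta> X in
      Ciphertext
        ((r * modular_inverse q \<beta>) mod q)
        ((h * modular_inverse q \<beta>) mod q)
        ([r] \<cdot>\<^bsub>grp pp\<^esub> gen pp)
        (\<Oplus>\<^bsub>grp pp\<^esub>j\<in>index_set pp. [r] \<cdot>\<^bsub>grp pp\<^esub> Y j)
        (hash3 pp ([(r * h * hash pp w)] \<cdot>\<^bsub>grp pp\<^esub> gen pp)))"

definition unit_scalar :: "('g, 'kw, 'tok, 'b) params \<Rightarrow> int pmf" where
  "unit_scalar pp = pmf_of_set {1..<modulus pp}"

definition encrypt ::
  "('g, 'kw, 'tok, 'b) params \<Rightarrow> int \<Rightarrow> 'g \<Rightarrow> (nat \<Rightarrow> 'g) \<Rightarrow> 'kw \<Rightarrow> ('g, 'b) ciphertext pmf" where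
  "encrypt pp \<eta> X Y w =
     do {
       r \<leftarrow> unit_scalar pp;
       h \<leftarrow> unit_scalar pp;
       return_pmf (ciphertext_with pp \<eta> X Y w r h)
     }"

definition trapdoor_with ::
  "('g, 'kw, 'tok, 'b) params \<Rightarrow> int \<Rightarrow> 'g \<Rightarrow> (nat \<Rightarrow> 'g) \<Rightarrow> nat \<Rightarrow> int \<Rightarrow> 'kw \<Rightarrow> 'g trapdoor" where
  "trapdoor_with pp \<eta> X Y i y w =
     (let q = modulus pp; \<beta> = beta pp \<eta> X in
      Trapdoor
        (\<Oplus>\<^bsub>grp pp\<^esub>j\<in>index_set pp - {i}. [\<beta>] \<cdot>\<^bsub>grp pp\<^esub> Y j)
        ((modular_inverse q (y - 1) * \<beta> * hash pp w) mod q))"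

definition test_value ::
  "('g, 'kw, 'tok, 'b) params \<Rightarrow> ('g, 'b) ciphertext \<Rightarrow> 'g trapdoor \<Rightarrow> 'b" where
  "test_value pp C T =
     hash3 pp ([(T2 T * C2 C)] \<cdot>\<^bsub>grp pp\<^esub>
       ((C5 C \<ominus>\<^bsub>grp pp\<^esub> [C1 C] \<cdot>\<^bsub>grp pp\<^esub> T1 T) \<ominus>\<^bsub>grp pp\<^esub> C3 C))"

definition test ::
  "('g, 'kw, 'tok, 'b) params \<Rightarrow> ('g, 'b) ciphertext \<Rightarrow> 'g trapdoor \<Rightarrow> bool" where
  "test pp C T \<longleftrightarrow> test_value pp C T = C6 C"

section \<open>The revised KT-IND-CKA game\<close>

text \<open>Probabilistic computations that may query ciphertexts and trapdoors.\<close>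

datatype ('kw, 'ct, 'td, 'a) comp =
    Done 'a
  | Rand "('kw, 'ct, 'td, 'a) comp pmf"
  | CtQuery 'kw "'ct \<Rightarrow> ('kw, 'ct, 'td, 'a) comp"
  | TdQuery nat 'kw "'td option \<Rightarrow> ('kw, 'ct, 'td, 'a) comp"

primrec run ::
  "('kw \<Rightarrow> 'ct pmf) \<Rightarrow> (nat \<Rightarrow> 'kw \<Rightarrow> 'td option) \<Rightarrow> ('kw, 'ct, 'td, 'a) comp \<Rightarrow> 'a pmf" where
  "run ct td (Done a) = return_pmf a"
| "run ct td (Rand p) = join_pmf (map_pmf (run ct td) p)"
| "run ct td (CtQuery w k) = bind_pmf (ct w) (\<lambda>c. run ct td (k c))"
| "run ct td (TdQuery j w k) = run ct td (k (td j w))"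

primrec query_free :: "('kw, 'ct, 'td, 'a) comp \<Rightarrow> bool" where
  "query_free (Done a) \<longleftrightarrow> True"
| "query_free (Rand p) \<longleftrightarrow> (\<forall>b\<in>set_pmf (map_pmf query_free p). b)"
| "query_free (CtQuery w k) \<longleftrightarrow> False"
| "query_free (TdQuery j w k) \<longleftrightarrow> False"

record ('g, 'tok) view =
  view_sender :: 'g
  view_receivers :: "nat \<Rightarrow> 'g"
  view_token :: 'tok
  view_partial_key :: int

definition registered_view ::
  "('g, 'kw, 'tok, 'b) params \<Rightarrow> 'tok secrets \<Rightarrow> ('g, 'tok) view" where
  "registered_view pp S =
     \<lparr>view_sender = sender_pub pp S, view_receivers = receiver_pub pp S,
      view_token = token S, view_partial_key = partial_key pp S\<rparr>"

definition sys_encrypt ::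
  "('g, 'kw, 'tok, 'b) params \<Rightarrow> 'tok secrets \<Rightarrow> 'kw \<Rightarrow> ('g, 'b) ciphertext pmf" where
  "sys_encrypt pp S = encrypt pp (partial_key pp S) (sender_pub pp S) (receiver_pub pp S)"

definition sys_trapdoor ::
  "('g, 'kw, 'tok, 'b) params \<Rightarrow> 'tok secrets \<Rightarrow> nat \<Rightarrow> 'kw \<Rightarrow> 'g trapdoor" where
  "sys_trapdoor pp S i =
     trapdoor_with pp (partial_key pp S) (sender_pub pp S) (receiver_pub pp S) i (receiver_key S i)"

definition trapdoor_oracle ::
  "('g, 'kw, 'tok, 'b) params \<Rightarrow> 'tok secrets \<Rightarrow> nat \<Rightarrow> 'kw \<Rightarrow> 'g trapdoor option" where
  "trapdoor_oracle pp S j w = (if j \<in> index_set pp then Some (sys_trapdoor pp S j w) else None)"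

text \<open>The first stage submits two keywords and a document and passes a state to the second.\<close>

record ('g, 'kw, 'tok, 'b, 'doc, 'st) adversary =
  submit :: "('g, 'tok) view
    \<Rightarrow> ('kw, ('g, 'b) ciphertext, 'g trapdoor, ('kw \<times> 'kw \<times> 'doc) \<times> 'st) comp"
  guess :: "'st \<Rightarrow> 'g trapdoor \<Rightarrow> ('kw, ('g, 'b) ciphertext, 'g trapdoor, bool) comp"

text \<open>
  The key distribution and the challenged receiver \<open>i\<close> are parameters of the game. Its result is
  the pair \<open>(b, b')\<close>, with \<^term>\<open>False\<close> for bit 0 and \<^term>\<open>True\<close> for bit 1.
\<close>

definition kt_ind_cka ::
  "('g, 'kw, 'tok, 'b) params \<Rightarrow> 'tok secrets pmf \<Rightarrow> nat
     \<Rightarrow> ('g, 'kw, 'tok, 'b, 'doc, 'st) adversary \<Rightarrow> (bool \<times> bool) pmf" where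
  "kt_ind_cka pp keys i A =
     do {
       S \<leftarrow> keys;
       ((w0, w1, d), st) \<leftarrow>
         run (sys_encrypt pp S) (trapdoor_oracle pp S) (submit A (registered_view pp S));
       b \<leftarrow> pmf_of_set (UNIV :: bool set);
       b' \<leftarrow>
         run (sys_encrypt pp S) (trapdoor_oracle pp S)
           (guess A st (sys_trapdoor pp S i (if b then w1 else w0)));
       return_pmf (b, b')
     }"

definition win_prob :: "(bool \<times> bool) pmf \<Rightarrow> real" where
  "win_prob g = measure_pmf.prob g {(b, b'). b' = b}"

definition advantage :: "(bool \<times> bool) pmf \<Rightarrow> real" where
  "advantage g = \<bar>win_prob g - 1 / 2\<bar>"

definition negligible_fun :: "(nat \<Rightarrow> real) \<Rightarrow> bool" where
  "negligible_fun f \<longleftrightarrow> (\<forall>c::nat. \<forall>\<^sub>F l in sequentially. \<bar>f l\<bar> < 1 / real l ^ c)"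

section \<open>The attack\<close>

text \<open>\<open>K\<close> is the distribution from which the adversary draws its two keywords.\<close>

definition attack ::
  "('g, 'kw, 'tok, 'b) params \<Rightarrow> ('kw \<times> 'kw) pmf \<Rightarrow> 'doc
     \<Rightarrow> ('g, 'kw, 'tok, 'b, 'doc, ('g, 'tok) view \<times> 'kw) adversary" where
  "attack pp K d =
     \<lparr>submit = (\<lambda>v. Rand (map_pmf (\<lambda>(w0, w1). Done ((w0, w1, d), (v, w0))) K)),
      guess = (\<lambda>(v, w0) T.
        Rand (map_pmf (\<lambda>C. Done (\<not> test pp C T))
          (encrypt pp (view_partial_key v) (view_sender v) (view_receivers v) w0)))\<rparr>"

definition attack_game ::
  "('g, 'kw, 'tok, 'b) params \<Rightarrow> 'tok secrets pmf \<Rightarrow> nat \<Rightarrow> ('kw \<times> 'kw) pmf \<Rightarrow> 'doc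
     \<Rightarrow> (bool \<times> bool) pmf" where
  "attack_game pp keys i K d = kt_ind_cka pp keys i (attack pp K d)"

section \<open>Hash collisions\<close>

text \<open>
  For fixed functions \<open>H\<close> and \<open>H\<^sub>3\<close> the hashed points of different keywords differ only barring
  collisions.
\<close>

definition collision_free :: "('g, 'kw, 'tok, 'b) params \<Rightarrow> ('kw \<times> 'kw) pmf \<Rightarrow> bool" where
  "collision_free pp K \<longleftrightarrow>
     (\<forall>(w0, w1)\<in>set_pmf K. hash pp w0 \<noteq> hash pp w1) \<and> inj_on (hash3 pp) (carrier (grp pp))"

text \<open>The probability that \<open>D\<close>, seen as a collision finder, outputs a collision of \<open>f\<close>.\<close>

definition collision_prob :: "('a \<Rightarrow> 'c) \<Rightarrow> ('a \<times> 'a) pmf \<Rightarrow> real" where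
  "collision_prob f D = measure_pmf.prob D {(a, b). a \<noteq> b \<and> f a = f b}"

definition point_pairs :: "('g, 'kw, 'tok, 'b) params \<Rightarrow> ('kw \<times> 'kw) pmf \<Rightarrow> ('g \<times> 'g) pmf" where
  "point_pairs pp K =
     do {
       (w0, w1) \<leftarrow> K;
       r \<leftarrow> unit_scalar pp;
       h \<leftarrow> unit_scalar pp;
       return_pmf ([(r * h * hash pp w0)] \<cdot>\<^bsub>grp pp\<^esub> gen pp, [(r * h * hash pp w1)] \<cdot>\<^bsub>grp pp\<^esub> gen pp)
     }"

end

theory Submission
  imports Defs "HOL-Algebra.Multiplicative_Group"
begin

text \<open>
  All points are multiples of the generator, so the test can be computed in the exponent. There
  \<open>C\<^sub>5 - C\<^sub>1 T\<^sub>1 - C\<^sub>3\<close> becomes \<open>r (y\<^sub>i - 1)\<close>, since \<open>C\<^sub>1 \<beta> = r\<close> cancels the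
  contributions of all receivers other than \<open>i\<close>, and \<open>T\<^sub>2 C\<^sub>2 = (y\<^sub>i - 1)\<^sup>-\<^sup>1 h H(w)\<close>. Hence the
  test compares the \<open>H\<^sub>3\<close>-values of \<open>r h H(w\<^sub>b) P\<close> and \<open>r h H(w\<^sub>0) P\<close>, independently of all
  secrets. The advantage of the attack is therefore exactly half the probability that these values
  differ for the two keywords, and this fails only in case of a collision of \<open>H\<close> or of \<open>H\<^sub>3\<close>.
\<close>

section \<open>Computing in the exponent\<close>

text \<open>In the application \<open>s\<close> is the sum of all receiver keys and \<open>t\<close>
  the sum without that of receiver \<open>i\<close>. The components \<open>c1\<close>,
  \<open>c2\<close>, \<open>t2\<close> are given only up to congruence, because the scheme reduces
  them modulo \<open>q\<close>.\<close>

lemma test_exponent_cong: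
  fixes \<beta> \<beta>' r h H s t y y' c1 c2 t2 :: int
  assumes \<beta>': "[\<beta>' * \<beta> = 1] (mod m)" and y': "[y' * (y - 1) = 1] (mod m)"
    and c1: "[c1 = r * \<beta>'] (mod m)" and c2: "[c2 = h * \<beta>'] (mod m)"
    and t2: "[t2 = y' * \<beta> * H] (mod m)" and s: "s = y + t"
  shows "[(r * s - \<beta> * t * c1 - r) * (t2 * c2) = r * h * H] (mod m)"
proof -
  have "[(r * s - \<beta> * t * c1 - r) * (t2 * c2)
      = (r * s - \<beta> * t * (r * \<beta>') - r) * (y' * \<beta> * H * (h * \<beta>'))] (mod m)"
    using c1 c2 t2 by (intro cong_mult cong_diff cong_refl)
  \<comment> \<open>Each factor \<open>\<beta>\<close> is paired with a \<open>\<beta>'\<close>, so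
    that the product can be replaced by 1.\<close>
  also have "(r * s - \<beta> * t * (r * \<beta>') - r) * (y' * \<beta> * H * (h * \<beta>'))
      = (r * s - (\<beta>' * \<beta>) * (t * r) - r) * ((\<beta>' * \<beta>) * (y' * H * h))"
    by (simp add: algebra_simps)
  also have "[\<dots> = (r * s - 1 * (t * r) - r) * (1 * (y' * H * h))] (mod m)"
    using \<beta>' by (intro cong_mult cong_diff cong_refl)
  \<comment> \<open>With \<open>s = y + t\<close> the terms \<open>t * r\<close> cancel and
    \<open>r * (y - 1)\<close> remains, which meets the inverse \<open>y'\<close> from the
    trapdoor.\<close>
  also have "(r * s - 1 * (t * r) - r) * (1 * (y' * H * h)) = (y' * (y - 1)) * (r * h * H)"
    by (simp add: s algebra_simps)
  also have "[\<dots> = 1 * (r * h * H)] (mod m)"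
    using y' by (intro cong_mult cong_refl)
  finally show ?thesis by simp
qed

text \<open>One instance of the scheme is fixed here; the asymptotic claims instantiate the locale
  at every security parameter.\<close>

locale dcc_se =
  fixes pp :: "('g, 'kw, 'tok, 'b) params"
  assumes valid: "valid_params pp"
begin

sublocale G: abelian_group "grp pp"
  using valid by (simp add: valid_params_def)

abbreviation q :: int where "q \<equiv> modulus pp"

abbreviation gen_pow :: "int \<Rightarrow> 'g" where "gen_pow k \<equiv> [k] \<cdot>\<^bsub>grp pp\<^esub> gen pp"

lemma gen_closed [simp]: "gen pp \<in> carrier (grp pp)"
  using valid unfolding valid_params_def by blast

lemma prime_modulus: "prime q"
  using valid by (simp add: valid_params_def modulus_def)

text \<open>The carrier consists of the multiples of \<open>gen pp\<close>, so the order of this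
  element is the order of the group, which is \<open>q\<close>.\<close>

lemma gen_pow_eq_iff: "gen_pow a = gen_pow b \<longleftrightarrow> [a = b] (mod q)"
proof -
  have "generate (add_monoid (grp pp)) {gen pp} = carrier (grp pp)"
    using G.add.generate_pow[OF gen_closed] valid by (auto simp: valid_params_def)
  then have "G.add.ord (gen pp) = order (grp pp)"
    using G.add.generate_pow_card[OF gen_closed] by (simp add: order_def)
  then show ?thesis
    using G.add.int_pow_eq[OF gen_closed, of a b]
    by (simp add: modulus_def cong_iff_dvd_diff dvd_diff_commute)
qed

lemma pow_gen_pow: "[a] \<cdot>\<^bsub>grp pp\<^esub> gen_pow b = gen_pow (b * a)"
  by (simp add: G.add.int_pow_pow)

lemma gen_pow_diff: "gen_pow a \<ominus>\<^bsub>grp pp\<^esub> gen_pow b = gen_pow (a - b)"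
  by (simp add: G.add.int_pow_diff a_minus_def)

lemma finsum_gen_pow:
  "finite A \<Longrightarrow> (\<Oplus>\<^bsub>grp pp\<^esub>j\<in>A. gen_pow (f j)) = gen_pow (\<Sum>j\<in>A. f j)"
  by (induction A rule: finite_induct) (simp_all add: G.add.int_pow_mult Pi_def add_pow_def[of _ "0 :: int"])

text \<open>The bound is on the absolute value because the lemma is applied to \<open>y - 1\<close>,
  which is -1 for the key \<open>y = 0\<close>.\<close>

lemma cong_modular_inverse_modulus:
  assumes "\<bar>a\<bar> < q" "a \<noteq> 0"
  shows "[modular_inverse q a * a = 1] (mod q)"
proof (rule cong_modular_inverse2)
  have "\<not> q dvd a"
    using assms dvd_imp_le_int[of a q] by auto
  then show "coprime a q"
    using prime_imp_coprime[OF prime_modulus] coprime_commute by blast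
qed

lemma finite_index_set [simp]: "finite (index_set pp)"
  by (simp add: index_set_def)

text \<open>This serves both \<open>C5\<close>, with all indices, and \<open>T1\<close>, with
  \<open>i\<close> removed. Inclusion in \<open>index_set pp\<close> matters since
  \<open>receiver_pub\<close> is a restricted function.\<close>

lemma finsum_pow_receiver_pub:
  assumes "A \<subseteq> index_set pp"
  shows "(\<Oplus>\<^bsub>grp pp\<^esub>j\<in>A. [a] \<cdot>\<^bsub>grp pp\<^esub> receiver_pub pp S j)
    = gen_pow (a * (\<Sum>j\<in>A. receiver_key S j))"
proof -
  have "(\<Oplus>\<^bsub>grp pp\<^esub>j\<in>A. [a] \<cdot>\<^bsub>grp pp\<^esub> receiver_pub pp S j)
      = (\<Oplus>\<^bsub>grp pp\<^esub>j\<in>A. gen_pow (a * receiver_key S j))"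
    using assms by (intro G.finsum_cong') (auto simp: receiver_pub_def pow_gen_pow mult.commute)
  then show ?thesis
    using assms finite_subset[OF assms] by (simp add: finsum_gen_pow sum_distrib_left)
qed

section \<open>Test values and the hashed points\<close>

abbreviation keyword_point :: "int \<Rightarrow> int \<Rightarrow> 'kw \<Rightarrow> 'g" where
  "keyword_point r h w \<equiv> gen_pow (r * h * hash pp w)"

lemma C6_ciphertext_with: "C6 (ciphertext_with pp \<eta> X Y w r h) = hash3 pp (keyword_point r h w)"
  by (simp add: ciphertext_with_def Let_def)

lemma test_value_sys_trapdoor:
  assumes S: "valid_secrets pp S" and i: "i \<in> index_set pp"
  shows "test_value pp
      (ciphertext_with pp (partial_key pp S) (sender_pub pp S) (receiver_pub pp S) w r h)
      (sys_trapdoor pp S i w') = hash3 pp (keyword_point r h w')"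
proof -
  define \<beta> where "\<beta> = beta pp (partial_key pp S) (sender_pub pp S)"
  define s where "s = (\<Sum>j\<in>index_set pp. receiver_key S j)"
  define t where "t = (\<Sum>j\<in>index_set pp - {i}. receiver_key S j)"
  define y where "y = receiver_key S i"
  define c1 where "c1 = (r * modular_inverse q \<beta>) mod q"
  define c2 where "c2 = (h * modular_inverse q \<beta>) mod q"
  define t2 where "t2 = (modular_inverse q (y - 1) * \<beta> * hash pp w') mod q"
  \<comment> \<open>The range of \<open>hash2\<close> is known only on the carrier, where the
    multiple of the sender's key lies.\<close>
  have "\<beta> \<in> {0..<q}" "\<beta> \<noteq> 0"
    using valid S unfolding \<beta>_def valid_params_def valid_secrets_def beta_def sender_pub_def
    by auto
  then have \<beta>_inv: "[modular_inverse q \<beta> * \<beta> = 1] (mod q)"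
    by (intro cong_modular_inverse_modulus) auto
  have "y \<in> {0..<q}" "y \<noteq> 1"
    using S i by (auto simp: y_def valid_secrets_def)
  moreover have "q > 1"
    using prime_modulus by (rule prime_gt_1_int)
  ultimately have y_inv: "[modular_inverse q (y - 1) * (y - 1) = 1] (mod q)"
    by (intro cong_modular_inverse_modulus) auto
  have "s = y + t"
    using i by (simp add: s_def t_def y_def sum.remove)
  then have "[(r * s - \<beta> * t * c1 - r) * (t2 * c2) = r * h * hash pp w'] (mod q)"
    by (intro test_exponent_cong[OF \<beta>_inv y_inv]) (auto simp: c1_def c2_def t2_def cong_def)
  then have "gen_pow ((r * s - \<beta> * t * c1 - r) * (t2 * c2)) = keyword_point r h w'"
    by (simp add: gen_pow_eq_iff)
  moreover have "test_value pp
      (ciphertext_with pp (partial_key pp S) (sender_pub pp S) (receiver_pub pp S) w r h)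
      (sys_trapdoor pp S i w')
      = hash3 pp (gen_pow ((r * s - \<beta> * t * c1 - r) * (t2 * c2)))"
    by (simp add: test_value_def ciphertext_with_def sys_trapdoor_def trapdoor_with_def Let_def
        finsum_pow_receiver_pub pow_gen_pow gen_pow_diff
        flip: \<beta>_def s_def t_def y_def c1_def c2_def t2_def)
  ultimately show ?thesis by simp
qed

text \<open>The factor \<open>r * h\<close> is a unit modulo the prime \<open>q\<close> and cancels.
  Hash values are reduced representatives, so their congruence is equality.\<close>

lemma keyword_point_eq_iff:
  assumes "r \<in> {1..<q}" "h \<in> {1..<q}"
  shows "keyword_point r h w = keyword_point r h w' \<longleftrightarrow> hash pp w = hash pp w'"
proof -
  have "\<not> q dvd r" "\<not> q dvd h"
    using assms zdvd_not_zless[of r q] zdvd_not_zless[of h q] by auto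
  then have "coprime (r * h) q"
    using prime_imp_coprime[OF prime_modulus] by (simp add: coprime_commute)
  then have "keyword_point r h w = keyword_point r h w' \<longleftrightarrow> [hash pp w = hash pp w'] (mod q)"
    by (simp add: gen_pow_eq_iff cong_mult_lcancel)
  moreover have "hash pp v \<in> {0..<q}" for v
    using valid by (simp add: valid_params_def)
  ultimately show ?thesis
    by (auto simp: cong_def)
qed

lemma set_pmf_unit_scalar: "set_pmf (unit_scalar pp) = {1..<q}"
  unfolding unit_scalar_def using prime_gt_1_int[OF prime_modulus]
  by (intro set_pmf_of_set) auto

lemma hash3_keyword_point_neq:
  assumes "collision_free pp K" "(w0, w1) \<in> set_pmf K" "r \<in> {1..<q}" "h \<in> {1..<q}"
  shows "hash3 pp (keyword_point r h w1) \<noteq> hash3 pp (keyword_point r h w0)"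
proof -
  have "hash pp w0 \<noteq> hash pp w1" "inj_on (hash3 pp) (carrier (grp pp))"
    using assms(1,2) by (auto simp: collision_free_def)
  then show ?thesis
    using keyword_point_eq_iff[OF assms(3,4), of w1 w0] by (auto dest: inj_onD)
qed

section \<open>The distribution of the attack game\<close>

lemma attack_game_eq:
  assumes keys: "\<And>S. S \<in> set_pmf keys \<Longrightarrow> valid_secrets pp S" and i: "i \<in> index_set pp"
  shows "attack_game pp keys i K d =
    map_pmf (\<lambda>(b, p0, p1). (b, b \<and> hash3 pp p0 \<noteq> hash3 pp p1))
      (pair_pmf (pmf_of_set UNIV) (point_pairs pp K))"
proof -
  let ?out = "\<lambda>w0 w1 b r h. return_pmf
    (b, b \<and> hash3 pp (keyword_point r h w0) \<noteq> hash3 pp (keyword_point r h w1))"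
  let ?ct = "\<lambda>S. ciphertext_with pp (partial_key pp S) (sender_pub pp S) (receiver_pub pp S)"
  \<comment> \<open>For \<open>b = False\<close> the test compares a value with itself and succeeds,
    which makes the guess False; this is the conjunct \<open>b\<close> in
    \<open>?out\<close>.\<close>
  have out: "return_pmf (b, \<not> test pp (?ct S w0 r h) (sys_trapdoor pp S i (if b then w1 else w0)))
      = ?out w0 w1 b r h" if "S \<in> set_pmf keys" for S w0 w1 b r h
    using keys[OF that] i by (auto simp: test_def test_value_sys_trapdoor C6_ciphertext_with)
  have "attack_game pp keys i K d =
      do {
        S \<leftarrow> keys;
        (w0, w1) \<leftarrow> K;
        b \<leftarrow> pmf_of_set UNIV;
        r \<leftarrow> unit_scalar pp;
        h \<leftarrow> unit_scalar pp;
        return_pmf (b, \<not> test pp (?ct S w0 r h) (sys_trapdoor pp S i (if b then w1 else w0)))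
      }"
    unfolding attack_game_def kt_ind_cka_def attack_def
    by (simp add: registered_view_def encrypt_def map_pmf_def join_pmf_def bind_assoc_pmf
        bind_return_pmf split_def cong: if_cong)
  also have "\<dots> =
      do {
        (S :: 'tok secrets) \<leftarrow> keys;
        (w0, w1) \<leftarrow> K;
        b \<leftarrow> pmf_of_set UNIV;
        r \<leftarrow> unit_scalar pp;
        h \<leftarrow> unit_scalar pp;
        ?out w0 w1 b r h
      }"
    by (intro bind_pmf_cong refl) (simp only: out)
  \<comment> \<open>The outcome no longer mentions \<open>S\<close>, so the draw of the keys
    disappears. The coin and the keywords are drawn independently, so the coin can be moved to the
    front.\<close>
  also have "\<dots> =
      do {
        b \<leftarrow> pmf_of_set UNIV;
        (w0, w1) \<leftarrow> K;
        r \<leftarrow> unit_scalar pp;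
        h \<leftarrow> unit_scalar pp;
        ?out w0 w1 b r h
      }"
    by (simp add: split_def bind_commute_pmf[of K])
  also have "\<dots> = map_pmf (\<lambda>(b, p0, p1). (b, b \<and> hash3 pp p0 \<noteq> hash3 pp p1))
      (pair_pmf (pmf_of_set UNIV) (point_pairs pp K))"
    by (simp add: pair_pmf_def point_pairs_def map_pmf_def bind_assoc_pmf bind_return_pmf split_def)
  finally show ?thesis .
qed

end

text \<open>On coin False the guess is always right; on coin True it is right exactly when
  \<open>Q\<close> holds.\<close>

lemma win_prob_coin_pair:
  "win_prob (map_pmf (\<lambda>(b, x). (b, b \<and> Q x)) (pair_pmf (pmf_of_set UNIV) D))
    = 1 / 2 + measure_pmf.prob D {x. Q x} / 2"
proof -
  let ?P = "measure_pmf.prob (pair_pmf (pmf_of_set UNIV) (map_pmf Q D))"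
  have "map_pmf (\<lambda>(b, x). (b, b \<and> Q x)) (pair_pmf (pmf_of_set UNIV) D)
      = map_pmf (\<lambda>(b, c). (b, b \<and> c)) (pair_pmf (pmf_of_set UNIV) (map_pmf Q D))"
    by (simp add: pair_map_pmf2 map_pmf_comp split_def)
  \<comment> \<open>The winning event is a disjoint union of two rectangles, to which the product
    formula for independent draws applies.\<close>
  moreover have "(\<lambda>(b, c). (b, b \<and> c)) -` {(b, b'). b' = b} = {False} \<times> UNIV \<union> {True} \<times> {True}"
    by auto
  ultimately have "win_prob (map_pmf (\<lambda>(b, x). (b, b \<and> Q x)) (pair_pmf (pmf_of_set UNIV) D))
      = ?P ({False} \<times> UNIV \<union> {True} \<times> {True})"
    unfolding win_prob_def by (simp only: measure_map_pmf)
  also have "\<dots> = ?P ({False} \<times> UNIV) + ?P ({True} \<times> {True})"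
    by (rule measure_pmf.finite_measure_Union; auto)
  also have "\<dots> = 1 / 2 + measure_pmf.prob D {x. Q x} / 2"
    by (simp add: measure_pmf_prob_product measure_pmf_of_set vimage_def del: insert_Times_insert)
  finally show ?thesis .
qed

section \<open>Advantage and correctness of the attack\<close>

context dcc_se
begin

lemma advantage_attack_game:
  assumes "\<And>S. S \<in> set_pmf keys \<Longrightarrow> valid_secrets pp S" "i \<in> index_set pp"
  shows "advantage (attack_game pp keys i K d)
    = measure_pmf.prob (point_pairs pp K) {(p0, p1). hash3 pp p0 \<noteq> hash3 pp p1} / 2"
proof -
  have "win_prob (attack_game pp keys i K d)
      = 1 / 2 + measure_pmf.prob (point_pairs pp K) {(p0, p1). hash3 pp p0 \<noteq> hash3 pp p1} / 2"
    using win_prob_coin_pair[of "\<lambda>(p0, p1). hash3 pp p0 \<noteq> hash3 pp p1" "point_pairs pp K"]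
    by (simp add: attack_game_eq[OF assms] split_def)
  then show ?thesis
    by (simp add: advantage_def)
qed

text \<open>For all nonzero \<open>r\<close> and \<open>h\<close> the two points coincide exactly
  when the keywords collide under \<open>hash pp\<close>, so the randomness has no influence on the
  event.\<close>

lemma point_pairs_collision:
  assumes "\<And>w0 w1. (w0, w1) \<in> set_pmf K \<Longrightarrow> w0 \<noteq> w1"
  shows "measure_pmf.prob (point_pairs pp K) {(p0, p1). p0 = p1} = collision_prob (hash pp) K"
proof -
  \<comment> \<open>Passing to the Boolean indicator of the event turns the claim into an equality
    of distributions.\<close>
  have "map_pmf (\<lambda>(p0, p1). p0 = p1) (point_pairs pp K) =
      do {
        (w0, w1) \<leftarrow> K;
        r \<leftarrow> unit_scalar pp;
        h \<leftarrow> unit_scalar pp;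
        return_pmf (keyword_point r h w0 = keyword_point r h w1)
      }"
    by (simp add: point_pairs_def map_pmf_def bind_assoc_pmf bind_return_pmf split_def)
  also have "\<dots> = do { (w0, w1) \<leftarrow> K; return_pmf (w0 \<noteq> w1 \<and> hash pp w0 = hash pp w1) }"
  proof (intro bind_pmf_cong refl, clarsimp)
    fix w0 w1
    assume K: "(w0, w1) \<in> set_pmf K"
    \<comment> \<open>The draws of \<open>r\<close> and \<open>h\<close> are first kept on both
      sides, so that their range is available for \<open>keyword_point_eq_iff\<close>, and then
      dropped as constant binds.\<close>
    have "do {
        r \<leftarrow> unit_scalar pp;
        h \<leftarrow> unit_scalar pp;
        return_pmf (keyword_point r h w0 = keyword_point r h w1)
      } = do {
        r \<leftarrow> unit_scalar pp;
        h \<leftarrow> unit_scalar pp;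
        return_pmf (w0 \<noteq> w1 \<and> hash pp w0 = hash pp w1)
      }"
      using assms[OF K]
      by (intro bind_pmf_cong refl) (simp add: keyword_point_eq_iff set_pmf_unit_scalar)
    then show "do {
        r \<leftarrow> unit_scalar pp;
        h \<leftarrow> unit_scalar pp;
        return_pmf (keyword_point r h w0 = keyword_point r h w1)
      } = return_pmf (w0 \<noteq> w1 \<and> hash pp w0 = hash pp w1)"
      by simp
  qed
  also have "\<dots> = map_pmf (\<lambda>(w0, w1). w0 \<noteq> w1 \<and> hash pp w0 = hash pp w1) K"
    by (simp add: map_pmf_def split_def)
  finally have eq: "map_pmf (\<lambda>(p0, p1). p0 = p1) (point_pairs pp K)
    = map_pmf (\<lambda>(w0, w1). w0 \<noteq> w1 \<and> hash pp w0 = hash pp w1) K" .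
  have "measure_pmf.prob (point_pairs pp K) {(p0, p1). p0 = p1}
      = measure_pmf.prob (map_pmf (\<lambda>(p0, p1). p0 = p1) (point_pairs pp K)) {True}"
    by (simp add: vimage_def split_def)
  also have "\<dots> = collision_prob (hash pp) K"
    unfolding eq by (simp add: collision_prob_def vimage_def split_def)
  finally show ?thesis .
qed

text \<open>Equal \<open>hash3\<close> values come either from equal points, hence from a collision
  of \<open>hash pp\<close>, or from a collision of \<open>hash3 pp\<close>; the union bound adds
  the two probabilities.\<close>

lemma advantage_attack_game_ge:
  assumes "\<And>S. S \<in> set_pmf keys \<Longrightarrow> valid_secrets pp S" "i \<in> index_set pp"
    and "\<And>w0 w1. (w0, w1) \<in> set_pmf K \<Longrightarrow> w0 \<noteq> w1"
  shows "advantage (attack_game pp keys i K d)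
    \<ge> (1 - collision_prob (hash pp) K - collision_prob (hash3 pp) (point_pairs pp K)) / 2"
proof -
  let ?P = "measure_pmf.prob (point_pairs pp K)"
  have "1 - ?P {(p0, p1). hash3 pp p0 \<noteq> hash3 pp p1} = ?P (- {(p0, p1). hash3 pp p0 \<noteq> hash3 pp p1})"
    using measure_pmf.prob_compl[of "{(p0, p1). hash3 pp p0 \<noteq> hash3 pp p1}" "point_pairs pp K"]
    by (simp add: Compl_eq_Diff_UNIV)
  also have "\<dots> \<le> ?P ({(p0, p1). p0 = p1} \<union> {(p0, p1). p0 \<noteq> p1 \<and> hash3 pp p0 = hash3 pp p1})"
    by (intro measure_pmf.finite_measure_mono) auto
  also have "\<dots> \<le> ?P {(p0, p1). p0 = p1} + ?P {(p0, p1). p0 \<noteq> p1 \<and> hash3 pp p0 = hash3 pp p1}"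
    by (intro measure_subadditive) auto
  also have "\<dots> = collision_prob (hash pp) K + collision_prob (hash3 pp) (point_pairs pp K)"
    by (simp add: point_pairs_collision[OF assms(3)] collision_prob_def)
  finally show ?thesis
    by (simp add: advantage_attack_game[OF assms(1,2)])
qed

lemma attack_game_False:
  assumes "\<And>S. S \<in> set_pmf keys \<Longrightarrow> valid_secrets pp S" "i \<in> index_set pp"
    and "(False, b') \<in> set_pmf (attack_game pp keys i K d)"
  shows "\<not> b'"
  using assms(3) by (auto simp: attack_game_eq[OF assms(1,2)])

text \<open>Freedom from collisions makes the inequality in \<open>attack_game_eq\<close> true for
  every pair of points in the support, so the guess reduces to \<open>b\<close>.\<close>

lemma attack_game_correct:
  assumes keys: "\<And>S. S \<in> set_pmf keys \<Longrightarrow> valid_secrets pp S" and i: "i \<in> index_set pp"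
    and K: "collision_free pp K"
    and game: "(b, b') \<in> set_pmf (attack_game pp keys i K d)"
  shows "b' = b"
proof -
  have "hash3 pp p0 \<noteq> hash3 pp p1" if "(p0, p1) \<in> set_pmf (point_pairs pp K)" for p0 p1
  proof -
    from that obtain w0 w1 r h where "(w0, w1) \<in> set_pmf K" "r \<in> {1..<q}" "h \<in> {1..<q}"
      "p0 = keyword_point r h w0" "p1 = keyword_point r h w1"
      by (auto simp: point_pairs_def set_pmf_unit_scalar)
    then show ?thesis
      using hash3_keyword_point_neq[OF K, of w0 w1 r h] by simp
  qed
  then show ?thesis
    using game by (auto simp: attack_game_eq[OF keys i])
qed

end

section \<open>Negligible functions\<close>

lemma negligible_fun_eventually_less:
  assumes "negligible_fun f" "\<epsilon> > 0"
  shows "\<forall>\<^sub>F l in sequentially. f l < \<epsilon>"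
proof -
  \<comment> \<open>The exponent 1 in the definition of negligibility suffices, as
    \<open>1 / real l\<close> tends to 0.\<close>
  have "\<forall>\<^sub>F l in sequentially. 1 / real l < \<epsilon>"
    using lim_1_over_n assms(2) by (rule order_tendstoD)
  moreover have "\<forall>\<^sub>F l in sequentially. \<bar>f l\<bar> < 1 / real l ^ 1"
    using assms(1) unfolding negligible_fun_def by blast
  ultimately show ?thesis
    by eventually_elim auto
qed

lemma not_negligible_if_complement:
  assumes "\<And>l. f l \<ge> (1 - g l - h l) / 2" "negligible_fun g" "negligible_fun h"
  shows "\<not> negligible_fun f"
proof
  assume "negligible_fun f"
  \<comment> \<open>If all three functions are below 1/4 at some \<open>l\<close>, then
    \<open>(1 - g l - h l) / 2\<close> exceeds 1/4 there, contradicting the bound on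
    \<open>f l\<close>.\<close>
  then have "\<forall>\<^sub>F l in sequentially. f l < 1 / 4 \<and> g l < 1 / 4 \<and> h l < 1 / 4"
    using assms(2,3) by (intro eventually_conj negligible_fun_eventually_less) auto
  then obtain l where "f l < 1 / 4" "g l < 1 / 4" "h l < 1 / 4"
    by (auto dest: eventually_happens)
  with assms(1)[of l] show False by simp
qed

lemma query_free_attack:
  "query_free (submit (attack pp K d) v)" "query_free (guess (attack pp K d) st T)"
  by (auto simp: attack_def split: prod.splits)

theorem mainTheorem1:
  fixes pp :: "nat \<Rightarrow> ('g, 'kw, 'tok, 'b) params"
    and keys :: "nat \<Rightarrow> 'tok secrets pmf"
    and i :: "nat \<Rightarrow> nat"
    and K :: "nat \<Rightarrow> ('kw \<times> 'kw) pmf"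
    and d :: "nat \<Rightarrow> 'doc"
  assumes "\<And>l. valid_params (pp l)"
    and "\<And>l S. S \<in> set_pmf (keys l) \<Longrightarrow> valid_secrets (pp l) S"
    and "\<And>l. i l \<in> index_set (pp l)"
    and "\<And>l w0 w1. (w0, w1) \<in> set_pmf (K l) \<Longrightarrow> w0 \<noteq> w1"
  shows
    "(\<forall>l v st T.
        query_free (submit (attack (pp l) (K l) (d l)) v) \<and>
        query_free (guess (attack (pp l) (K l) (d l)) st T)) \<and>
     (\<forall>l. \<forall>S\<in>set_pmf (keys l). \<forall>(w0, w1)\<in>set_pmf (K l).
        \<forall>r\<in>{1..<modulus (pp l)}. \<forall>h\<in>{1..<modulus (pp l)}.
        let C = ciphertext_with (pp l) (partial_key (pp l) S) (sender_pub (pp l) S)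
                  (receiver_pub (pp l) S) w0 r h;
            T = sys_trapdoor (pp l) S (i l);
            R = (\<lambda>w. hash3 (pp l) ([(r * h * hash (pp l) w)] \<cdot>\<^bsub>grp (pp l)\<^esub> gen (pp l)))
        in C6 C = R w0 \<and>
           test_value (pp l) C (T w0) = R w0 \<and>
           test_value (pp l) C (T w1) = R w1 \<and>
           (collision_free (pp l) (K l) \<longrightarrow> R w1 \<noteq> R w0)) \<and>
     (\<forall>l. \<forall>(b, b')\<in>set_pmf (attack_game (pp l) (keys l) (i l) (K l) (d l)). b = False \<longrightarrow> b' = False) \<and>
     (\<forall>l. collision_free (pp l) (K l) \<longrightarrow>
        (\<forall>(b, b')\<in>set_pmf (attack_game (pp l) (keys l) (i l) (K l) (d l)). b = True \<longrightarrow> b' = True) \<and>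
        (\<forall>(b, b')\<in>set_pmf (attack_game (pp l) (keys l) (i l) (K l) (d l)). b' = b) \<and>
        win_prob (attack_game (pp l) (keys l) (i l) (K l) (d l)) = 1 \<and>
        advantage (attack_game (pp l) (keys l) (i l) (K l) (d l)) = 1 / 2) \<and>
     ((\<forall>l. collision_free (pp l) (K l)) \<longrightarrow>
        \<not> negligible_fun (\<lambda>l. advantage (attack_game (pp l) (keys l) (i l) (K l) (d l)))) \<and>
     (negligible_fun (\<lambda>l. collision_prob (hash (pp l)) (K l)) \<longrightarrow>
      negligible_fun (\<lambda>l. collision_prob (hash3 (pp l)) (point_pairs (pp l) (K l))) \<longrightarrow>
        \<not> negligible_fun (\<lambda>l. advantage (attack_game (pp l) (keys l) (i l) (K l) (d l))))"
proof -
  have scheme: "dcc_se (pp l)" for l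
    using assms(1) by (rule dcc_se.intro)
  let ?game = "\<lambda>l. attack_game (pp l) (keys l) (i l) (K l) (d l)"
  have lose: "\<not> b'" if "(False, b') \<in> set_pmf (?game l)" for l b'
    by (rule dcc_se.attack_game_False[OF scheme assms(2,3) that])
  have correct: "b' = b" if "collision_free (pp l) (K l)" "(b, b') \<in> set_pmf (?game l)" for l b b'
    by (rule dcc_se.attack_game_correct[OF scheme assms(2,3) that])
  have win: "win_prob (?game l) = 1" if "collision_free (pp l) (K l)" for l
    unfolding win_prob_def using correct[OF that]
    by (auto simp: measure_pmf.prob_eq_1 AE_measure_pmf_iff)
  then have adv: "advantage (?game l) = 1 / 2" if "collision_free (pp l) (K l)" for l
    using that by (simp add: advantage_def)
  have test: "C6 C = R w0 \<and> test_value (pp l) C (T w0) = R w0 \<and> test_value (pp l) C (T w1) = R w1 \<and>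
      (collision_free (pp l) (K l) \<longrightarrow> R w1 \<noteq> R w0)"
    if "S \<in> set_pmf (keys l)" "(w0, w1) \<in> set_pmf (K l)"
      "r \<in> {1..<modulus (pp l)}" "h \<in> {1..<modulus (pp l)}"
      "C = ciphertext_with (pp l) (partial_key (pp l) S) (sender_pub (pp l) S)
         (receiver_pub (pp l) S) w0 r h"
      "T = sys_trapdoor (pp l) S (i l)"
      "R = (\<lambda>w. hash3 (pp l) ([(r * h * hash (pp l) w)] \<cdot>\<^bsub>grp (pp l)\<^esub> gen (pp l)))"
    for l S w0 w1 r h C T R
    unfolding that(5-7)
    using dcc_se.C6_ciphertext_with[OF scheme]
      dcc_se.test_value_sys_trapdoor[OF scheme assms(2)[OF that(1)] assms(3)]
      dcc_se.hash3_keyword_point_neq[OF scheme _ that(2-4)] by blast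
  have collision_free: "\<not> negligible_fun (\<lambda>l. advantage (?game l))"
    if "\<forall>l. collision_free (pp l) (K l)"
  proof
    assume "negligible_fun (\<lambda>l. advantage (?game l))"
    \<comment> \<open>The advantage is constantly 1/2, so it cannot eventually be below 1/2.\<close>
    then have "\<forall>\<^sub>F l in sequentially. advantage (?game l) < 1 / 2"
      by (rule negligible_fun_eventually_less) simp
    then show False
      using that by (simp add: adv)
  qed
  have negligible: "\<not> negligible_fun (\<lambda>l. advantage (?game l))"
    if "negligible_fun (\<lambda>l. collision_prob (hash (pp l)) (K l))"
      "negligible_fun (\<lambda>l. collision_prob (hash3 (pp l)) (point_pairs (pp l) (K l)))"
    by (rule not_negligible_if_complement[OF dcc_se.advantage_attack_game_ge[OF scheme assms(2-4)] that])
  show ?thesis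
  proof (intro conjI, goal_cases)
    case 1
    show ?case by (simp add: query_free_attack)
  next
    case 2
    show ?case
      unfolding Let_def using test[OF _ _ _ _ refl refl refl] by (intro allI ballI case_prodI2) blast
  next
    case 3
    show ?case by (auto dest: lose)
  next
    case 4
    show ?case by (auto dest: correct simp: win adv)
  next
    case 5
    show ?case using collision_free by blast
  next
    case 6
    show ?case using negligible by blast
  qed
qed

end
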